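(* Let $\kappa_*\ge1$, $d\ge2$ and $T\ge4^3\kappa_*$. There exists an action set $\mathcal A\in\mathbf A_{\kappa_*,d}$ such that for any algorithm there exists a biased linear bandit problem on $\mathcal A$ with parameter $\theta_T\in\mathbb R^{d+1}$ such that the regret of this algorithm on the problem characterized by $\theta_T$ satisfies $$R_T^{\theta_T}\ge\frac{\kappa_*^{1/3}T^{2/3}}{8e}.$$
   Context: **Biased linear bandit.** An action set is a finite set $\mathcal A=\{\binom{x}{z_x}:x\in\mathcal X\}\subset\mathbb R^d\times\{-1,1\}$, with distinct covariates $x\in\mathcal X\subset\mathbb R^d$ and known sensitive attributes (groups) $z_x\in\{-1,1\}$; both groups are nonempty and $\mathcal A$ spans $\mathbb R^{d+1}$. A problem is characterized by a parameter $\theta=\binom{\gamma}{\omega}$, $\gamma\in\mathbb R^d$, $\omega\in\mathbb R$, with $\max_{x\in\mathcal X}|x^\top\gamma|\le1$. At each round $t\le T$ the player (algorithm) chooses $x_t\in\mathcal X$ based on past choices and observations (and possibly independent randomization) and observes $y_t=x_t^\top\gamma+z_{x_t}\omega+\xi_t$ with $\xi_t$ i.i.d. $\mathcal N(0,1)$. The regret is $R_T^\theta=\mathbb E\big[\sum_{t\le T}(x^*-x_t)^\top\gamma\big]$ with $x^*\in\arg\max_{x\in\mathcal X}x^\top\gamma$. **$\kappa_*$-correlated action sets.** Let $e_{d+1}$ be the last canonical basis vector of $\mathbb R^{d+1}$ and $M^+$ a generalized inverse of $M$. $\mathbf A_{\kappa_*,d}$ is the set of action sets $\mathcal A$ such that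 $$\min_{\pi}\ e_{d+1}^\top\Big(\sum_{a\in\mathcal A}\pi(a)aa^\top\Big)^+e_{d+1}\ \ge\ \kappa_*,$$ the minimum being over probability measures $\pi$ on $\mathcal A$ with $e_{d+1}\in\mathrm{Range}\big(\sum_{a\in\mathcal A}\pi(a)aa^\top\big)$. *)

theory Defs
  imports "HOL-Probability.Probability"
begin

text \<open>
  Covariates live in \<open>real ^ 'n\<close> with \<open>d = CARD('n)\<close>, and \<open>\<real>\<^sup>d\<^sup>+\<^sup>1\<close> is
  \<open>real ^ 'n option\<close>: the coordinates \<open>Some i\<close> are those of the covariate, and \<open>None\<close>
  is the last one. An action set is given by its covariates \<open>X\<close> and the group map \<open>z\<close>;
  covariates are then automatically distinct.
\<close>

definition lift_action :: "real ^ 'n \<Rightarrow> real \<Rightarrow> real ^ 'n option" where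
  "lift_action x s = (\<chi> i. case i of None \<Rightarrow> s | Some j \<Rightarrow> x $ j)"

definition actions :: "(real ^ 'n) set \<Rightarrow> (real ^ 'n \<Rightarrow> real) \<Rightarrow> (real ^ 'n option) set" where
  "actions X z = (\<lambda>x. lift_action x (z x)) ` X"

text \<open>The equation \<open>z ` X = {-1, 1}\<close> says both that groups are \<open>\<plusminus>1\<close> and that none is empty.\<close>

definition action_set :: "(real ^ 'n::finite) set \<Rightarrow> (real ^ 'n \<Rightarrow> real) \<Rightarrow> bool" where
  "action_set X z \<longleftrightarrow> finite X \<and> z ` X = {-1, 1} \<and> span (actions X z) = UNIV"


section \<open>Correlated action sets\<close>

definition outer :: "real ^ 'm \<Rightarrow> real ^ 'm ^ 'm" where
  "outer a = (\<chi> i j. a $ i * a $ j)"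

definition design_matrix :: "(real ^ 'm) set \<Rightarrow> (real ^ 'm) pmf \<Rightarrow> real ^ 'm ^ 'm" where
  "design_matrix A p = (\<Sum>a\<in>A. pmf p a *\<^sub>R outer a)"

definition generalized_inverse :: "real ^ 'm ^ 'm \<Rightarrow> real ^ 'm ^ 'm \<Rightarrow> bool" where
  "generalized_inverse M G \<longleftrightarrow> M ** G ** M = M"

abbreviation e_last :: "real ^ 'n::finite option" where
  "e_last \<equiv> axis None 1"

text \<open>
  As \<open>e_last\<close> lies in the range of the symmetric matrix \<open>M\<close>, the value
  \<open>e_last \<bullet> (G *v e_last)\<close> is the same for all generalized inverses \<open>G\<close> of \<open>M\<close>.
  When \<open>A\<close> is finite and spans the space, the set below is nonempty and its infimum is
  attained.
\<close>

definition bias_variances :: "(real ^ 'n::finite option) set \<Rightarrow> real set" where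
  "bias_variances A =
     {e_last \<bullet> (G *v e_last) | p G.
        set_pmf p \<subseteq> A \<and> e_last \<in> range (\<lambda>v. design_matrix A p *v v)
        \<and> generalized_inverse (design_matrix A p) G}"

definition correlated_action_sets ::
    "real \<Rightarrow> ((real ^ 'n::finite) set \<times> (real ^ 'n \<Rightarrow> real)) set" where
  "correlated_action_sets \<kappa> =
     {(X, z). action_set X z \<and> Inf (bias_variances (actions X z)) \<ge> \<kappa>}"


section \<open>Algorithms, problems and regret\<close>

definition gam :: "real ^ 'n::finite option \<Rightarrow> real ^ 'n" where
  "gam \<theta> = (\<chi> i. \<theta> $ Some i)"

definition om :: "real ^ 'n::finite option \<Rightarrow> real" where
  "om \<theta> = \<theta> $ None"

definition bandit_parameter :: "(real ^ 'n::finite) set \<Rightarrow> real ^ 'n option \<Rightarrow> bool" where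
  "bandit_parameter X \<theta> \<longleftrightarrow> (\<forall>x\<in>X. \<bar>x \<bullet> gam \<theta>\<bar> \<le> 1)"

text \<open>
  Rounds are numbered \<open>0, \<dots>, T - 1\<close>. The history before round \<open>t\<close> is an extensional
  function on \<open>{..<t}\<close> giving the past choices and observations. An algorithm draws a seed
  from an arbitrary probability space \<open>S\<close>, independently of the noise, and in round \<open>t\<close>
  chooses a measurable function of the seed and the history. The seed is a sequence of reals,
  with arbitrary law and sigma-algebra, so that it can provide randomness shared between
  rounds as well as fresh randomness in each round.
\<close>

type_synonym seed = "nat \<Rightarrow> real"
type_synonym 'n history = "nat \<Rightarrow> (real ^ 'n) \<times> real"
type_synonym 'n policy = "nat \<Rightarrow> seed \<Rightarrow> 'n history \<Rightarrow> real ^ 'n"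

definition bandit_algorithm ::
    "nat \<Rightarrow> (real ^ 'n) set \<Rightarrow> seed measure \<Rightarrow> 'n policy \<Rightarrow> bool" where
  "bandit_algorithm T X S alg \<longleftrightarrow> prob_space S \<and>
     (\<forall>t<T. (\<lambda>(u, h). alg t u h)
        \<in> measurable (S \<Otimes>\<^sub>M PiM {..<t} (\<lambda>_. count_space X \<Otimes>\<^sub>M borel)) (count_space X))"

primrec run_history ::
    "(real ^ 'n \<Rightarrow> real) \<Rightarrow> real ^ 'n::finite option \<Rightarrow> 'n policy \<Rightarrow> seed \<Rightarrow> (nat \<Rightarrow> real)
      \<Rightarrow> nat \<Rightarrow> 'n history" where
  "run_history z \<theta> alg u \<xi> 0 = (\<lambda>_. undefined)"
| "run_history z \<theta> alg u \<xi> (Suc t) =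
     (let h = run_history z \<theta> alg u \<xi> t; x = alg t u h
      in h(t := (x, x \<bullet> gam \<theta> + z x * om \<theta> + \<xi> t)))"

definition chosen ::
    "(real ^ 'n \<Rightarrow> real) \<Rightarrow> real ^ 'n::finite option \<Rightarrow> 'n policy \<Rightarrow> seed \<Rightarrow> (nat \<Rightarrow> real)
      \<Rightarrow> nat \<Rightarrow> real ^ 'n" where
  "chosen z \<theta> alg u \<xi> t = alg t u (run_history z \<theta> alg u \<xi> t)"

definition noise :: "(nat \<Rightarrow> real) measure" where
  "noise = PiM UNIV (\<lambda>_. std_normal_distribution)"

definition regret ::
    "nat \<Rightarrow> (real ^ 'n::finite) set \<Rightarrow> (real ^ 'n \<Rightarrow> real) \<Rightarrow> seed measure \<Rightarrow> 'n policy
      \<Rightarrow> real ^ 'n option \<Rightarrow> real" where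
  "regret T X z S alg \<theta> =
     (let best = arg_max_on (\<lambda>x. x \<bullet> gam \<theta>) X
      in \<integral>(u, \<xi>). (\<Sum>t<T. (best - chosen z \<theta> alg u \<xi> t) \<bullet> gam \<theta>) \<partial>(S \<Otimes>\<^sub>M noise))"

end

theory Submission
  imports Defs
begin

text \<open>
  The theorem rests on one observation: an action far from optimal may be the only source of
  information on the bias. The hard action set consists of the canonical basis vectors, one of them,
  \<open>axis i 1\<close>, alone in its group, and of a probe \<open>- \<alpha> *\<^sub>R axis i 1\<close> in the other group. Raising the
  reward of \<open>axis i 1\<close> by \<open>\<epsilon>\<close>, lowering that of the other basis vectors by \<open>\<epsilon>\<close> and lowering the
  bias by \<open>\<epsilon>\<close> changes no observation at a basis vector; at the probe it changes the mean by
  \<open>(1 - \<alpha>) \<epsilon>\<close> only. Since \<open>1 - \<alpha>\<close> is of order \<open>1 / sqrt \<kappa>\<close>, finding the sign of \<open>\<epsilon>\<close> takes about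
  \<open>\<kappa> / \<epsilon>\<^sup>2\<close> plays of the probe, each at constant regret, while not finding it costs regret of order
  \<open>\<epsilon> T\<close>. Both are of order \<open>\<kappa>\<^sup>1\<^sup>/\<^sup>3 T\<^sup>2\<^sup>/\<^sup>3\<close> when \<open>\<epsilon>\<close> is \<open>\<delta> = (\<kappa> / T)\<^sup>1\<^sup>/\<^sup>3\<close>.

  That the action set is \<open>\<kappa>\<close>-correlated is shown by a dual certificate for the optimal design
  (\<open>correlated_action_setI\<close>, \<open>hard_correlated\<close>).

  For the regret, the three problems \<open>\<epsilon> = \<delta>\<close>, \<open>\<epsilon> = - \<delta>\<close> and \<open>\<epsilon> = 0\<close> are compared on the
  probability space of the last one, where the likelihood ratios of the other two are explicit
  exponentials (\<open>change_of_measure\<close>). The middle problem serves a double purpose. By symmetry the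
  noise cancels in the product of the two likelihood ratios, whose square root is therefore a
  function of the number \<open>N\<close> of plays of the probe alone. And the algorithm must
  also do well in the middle problem, which bounds the expectation of \<open>N\<close>. The outcome is \<open>three_point_bound\<close>, an inequality between the three regrets
  that fails if all of them are too small.
\<close>

section \<open>Dual certificates for optimal designs\<close>

lemma design_matrix_vec:
  fixes A :: "(real ^ 'm::finite) set"
  shows "design_matrix A p *v w = (\<Sum>a\<in>A. (pmf p a * (a \<bullet> w)) *\<^sub>R a)"
proof (simp add: vec_eq_iff, intro allI)
  fix i
  have "(design_matrix A p *v w) $ i = (\<Sum>j\<in>UNIV. \<Sum>a\<in>A. pmf p a * (a $ i * a $ j) * w $ j)"
    by (simp add: design_matrix_def outer_def matrix_vector_mult_def sum_distrib_right)
  also have "\<dots> = (\<Sum>a\<in>A. \<Sum>j\<in>UNIV. pmf p a * (a $ i * a $ j) * w $ j)"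
    by (rule sum.swap)
  also have "\<dots> = (\<Sum>a\<in>A. pmf p a * (a \<bullet> w) * a $ i)"
    by (intro sum.cong refl) (simp add: inner_vec_def sum_distrib_left sum_distrib_right algebra_simps)
  finally show "(design_matrix A p *v w) $ i = (\<Sum>a\<in>A. pmf p a * (a \<bullet> w) * a $ i)" .
qed

lemma design_matrix_inner:
  fixes A :: "(real ^ 'm::finite) set"
  shows "v \<bullet> (design_matrix A p *v w) = (\<Sum>a\<in>A. pmf p a * (a \<bullet> v) * (a \<bullet> w))"
  by (simp add: design_matrix_vec inner_sum_right inner_commute algebra_simps)

text \<open>
  The weak half of Elfving's theorem. With \<open>e = M w\<close>, the quadratic form of every generalized
  inverse at \<open>e\<close> is the second moment of \<open>a \<bullet> w\<close> under the design, and \<open>e \<bullet> y\<close> is its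
  correlation with \<open>a \<bullet> y\<close>, which is bounded by 1: Cauchy-Schwarz. A vector \<open>y\<close> thus bounds the
  variance from below for all designs at once.
\<close>

lemma design_variance_ge:
  fixes A :: "(real ^ 'm::finite) set"
  assumes fin: "finite A" and y: "\<And>a. a \<in> A \<Longrightarrow> \<bar>a \<bullet> y\<bar> \<le> 1"
    and e: "e \<in> range (\<lambda>v. design_matrix A p *v v)"
    and G: "generalized_inverse (design_matrix A p) G"
  shows "(e \<bullet> y)\<^sup>2 \<le> e \<bullet> (G *v e)"
proof -
  let ?M = "design_matrix A p"
  obtain w where w: "e = ?M *v w" using e by auto
  define s where "s = e \<bullet> y"
  have sy: "s = (\<Sum>a\<in>A. pmf p a * (a \<bullet> y) * (a \<bullet> w))"
    by (simp add: s_def w design_matrix_inner inner_commute[of _ y])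
  have "e \<bullet> (G *v e) = w \<bullet> (?M *v (G *v (?M *v w)))"
    by (simp add: w design_matrix_inner inner_commute[of "?M *v w"] ac_simps)
  also have "\<dots> = w \<bullet> (?M *v w)"
    using G by (simp add: generalized_inverse_def matrix_vector_mul_assoc matrix_mul_assoc)
  also have "\<dots> = (\<Sum>a\<in>A. pmf p a * (a \<bullet> w)\<^sup>2)"
    by (simp add: design_matrix_inner power2_eq_square ac_simps)
  finally have eG: "e \<bullet> (G *v e) = (\<Sum>a\<in>A. pmf p a * (a \<bullet> w)\<^sup>2)" .
  have p1: "sum (pmf p) A \<le> 1"
    using fin by (metis measure_measure_pmf_finite measure_pmf.prob_le_1)
  have y2: "(\<Sum>a\<in>A. pmf p a * (a \<bullet> y)\<^sup>2) \<le> 1"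
  proof (rule order_trans[OF sum_mono p1])
    fix a assume "a \<in> A"
    then show "pmf p a * (a \<bullet> y)\<^sup>2 \<le> pmf p a"
      using y[of a] by (simp add: mult_left_le abs_square_le_1)
  qed
  \<comment> \<open>Cauchy-Schwarz in its elementary form, with the factor \<open>s\<close> that makes the bound \<open>s\<^sup>2\<close>.\<close>
  have "0 \<le> (\<Sum>a\<in>A. pmf p a * ((a \<bullet> w) - s * (a \<bullet> y))\<^sup>2)"
    by (intro sum_nonneg) simp
  also have "\<dots> = (\<Sum>a\<in>A. pmf p a * (a \<bullet> w)\<^sup>2) - 2 * s * s + s\<^sup>2 * (\<Sum>a\<in>A. pmf p a * (a \<bullet> y)\<^sup>2)"
    by (subst (2) sy) (simp add: power2_eq_square algebra_simps sum.distrib sum_subtractf sum_distrib_left)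
  also have "\<dots> \<le> e \<bullet> (G *v e) - 2 * s * s + s\<^sup>2 * 1"
    unfolding eG by (intro add_mono order_refl mult_left_mono y2) simp
  finally show ?thesis by (simp add: s_def power2_eq_square)
qed

text \<open>
  The infimum of the empty set of reals is an unspecified number, so the lower bound below needs
  one admissible design. The uniform one has a positive definite design matrix because \<open>A\<close> spans.
\<close>

lemma bias_variances_nonempty:
  fixes A :: "(real ^ 'n::finite option) set"
  assumes fin: "finite A" and sp: "span A = UNIV"
  shows "bias_variances A \<noteq> {}"
proof -
  have "A \<noteq> {}"
  proof
    assume "A = {}"
    then have "(e_last :: real ^ 'n option) = 0" using sp by auto
    then show False by (simp add: axis_eq_0_iff)
  qed
  define p where "p = pmf_of_set A"
  have p: "set_pmf p = A" "\<And>a. a \<in> A \<Longrightarrow> pmf p a > 0"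
    using fin \<open>A \<noteq> {}\<close> by (auto simp: p_def card_gt_0_iff)
  let ?M = "design_matrix A p"
  have ker: "w = 0" if "?M *v w = 0" for w
  proof -
    have "(\<Sum>a\<in>A. pmf p a * (a \<bullet> w) * (a \<bullet> w)) = 0"
      using design_matrix_inner[of w A p w] that by simp
    then have "\<forall>a\<in>A. pmf p a * (a \<bullet> w) * (a \<bullet> w) = 0"
      by (subst (asm) sum_nonneg_eq_0_iff[OF fin]) (auto simp: mult.assoc)
    then have "a \<bullet> w = 0" if "a \<in> A" for a using p(2)[OF that] that by fastforce
    then have "orthogonal w a" if "a \<in> span A" for a
      using that orthogonal_to_span[of a A w] by (simp add: orthogonal_def inner_commute)
    then show "w = 0" using sp by (metis UNIV_I orthogonal_self)
  qed
  then obtain B where B: "B ** ?M = mat 1" using matrix_left_invertible_ker[of ?M] by blast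
  then have B': "?M ** B = mat 1" by (simp add: matrix_left_right_inverse)
  have "e_last = ?M *v (B *v e_last)" by (simp add: matrix_vector_mul_assoc B')
  then have "e_last \<in> range (\<lambda>v. ?M *v v)" by blast
  moreover have "generalized_inverse ?M B" by (simp add: generalized_inverse_def B')
  ultimately show ?thesis using p(1) unfolding bias_variances_def by blast
qed

lemma correlated_action_setI:
  assumes X: "action_set X z" and y: "\<And>x. x \<in> X \<Longrightarrow> \<bar>lift_action x (z x) \<bullet> y\<bar> \<le> 1"
  shows "(X, z) \<in> correlated_action_sets ((y $ None)\<^sup>2)"
proof -
  have fin: "finite (actions X z)" and sp: "span (actions X z) = UNIV"
    using X by (auto simp: action_set_def actions_def)
  have ey: "e_last \<bullet> y = y $ None" by (simp add: inner_axis inner_commute)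
  have "Inf (bias_variances (actions X z)) \<ge> (y $ None)\<^sup>2"
  proof (rule cInf_greatest[OF bias_variances_nonempty[OF fin sp]])
    fix v assume "v \<in> bias_variances (actions X z)"
    then obtain p G where "v = e_last \<bullet> (G *v e_last)"
        "e_last \<in> range (\<lambda>v. design_matrix (actions X z) p *v v)"
        "generalized_inverse (design_matrix (actions X z) p) G"
      unfolding bias_variances_def by blast
    then show "(y $ None)\<^sup>2 \<le> v"
      using design_variance_ge[OF fin, of y e_last p G] y by (auto simp: ey actions_def)
  qed
  then show ?thesis using X by (simp add: correlated_action_sets_def)
qed

lemma inner_lift_action:
  fixes y :: "real ^ 'n::finite option"
  shows "lift_action x s \<bullet> y = x \<bullet> gam y + s * om y"
proof -
  have "(\<Sum>i\<in>UNIV. f i) = f None + (\<Sum>j\<in>UNIV. f (Some j))" for f :: "'n option \<Rightarrow> real"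
    by (simp add: UNIV_option_conv sum.reindex)
  then show ?thesis by (simp add: inner_vec_def lift_action_def gam_def om_def)
qed

section \<open>The hard action set\<close>

text \<open>
  The action \<open>- \<alpha> *\<^sub>R axis i 1\<close> is called the probe. It is the only action besides \<open>axis i 1\<close>
  on the line through \<open>axis i 1\<close>, and it lies in the other group. All canonical basis vectors
  except \<open>axis i 1\<close> are put into the group of the probe, so that comparing \<open>axis i 1\<close> with any of
  them requires knowing the bias.
\<close>

definition hard_actions :: "'n::finite \<Rightarrow> real \<Rightarrow> (real ^ 'n) set" where
  "hard_actions i \<alpha> = insert (- \<alpha> *\<^sub>R axis i 1) (range (\<lambda>j. axis j 1))"

definition hard_groups :: "'n::finite \<Rightarrow> real ^ 'n \<Rightarrow> real" where
  "hard_groups i x = (if x = axis i 1 then 1 else - 1)"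

text \<open>
  Moving along \<open>\<epsilon>\<close> exchanges the amount \<open>\<epsilon>\<close> between the bias and the rewards. At the basis vectors
  the two effects cancel in the observation: its mean is \<open>m\<close> for all \<open>\<epsilon>\<close>. The sign of \<open>\<epsilon>\<close> decides
  whether \<open>axis i 1\<close> or the other basis vectors are best.
\<close>

definition hard_parameter :: "'n::finite \<Rightarrow> real \<Rightarrow> real \<Rightarrow> real ^ 'n option" where
  "hard_parameter i m \<epsilon> =
     (\<chi> k. case k of None \<Rightarrow> - \<epsilon> | Some j \<Rightarrow> if j = i then m + \<epsilon> else m - \<epsilon>)"

lemma probe_neq_axis:
  assumes "0 \<le> \<alpha>" shows "- \<alpha> *\<^sub>R axis i 1 \<noteq> (axis j 1 :: real ^ 'n::finite)"
proof
  assume "- \<alpha> *\<^sub>R axis i 1 = (axis j 1 :: real ^ 'n::finite)"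
  then have "(- \<alpha> *\<^sub>R axis i 1) $ j = (axis j 1 :: real ^ 'n::finite) $ j" by simp
  then show False using assms by (auto simp: axis_def split: if_splits)
qed

lemma action_set_hard:
  fixes i :: "'n::finite"
  assumes "0 \<le> \<alpha>" "\<alpha> < 1"
  shows "action_set (hard_actions i \<alpha>) (hard_groups i)"
  unfolding action_set_def
proof (intro conjI)
  let ?X = "hard_actions i \<alpha>" and ?z = "hard_groups i"
  show "finite ?X" by (simp add: hard_actions_def)
  show "?z ` ?X = {-1, 1}"
    using probe_neq_axis[OF assms(1), of i i] by (auto simp: hard_actions_def hard_groups_def)
  let ?S = "span (actions ?X ?z)"
  have ax: "lift_action (axis j 1) (?z (axis j 1)) \<in> ?S" for j
    by (rule span_base) (simp add: actions_def hard_actions_def)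
  have pr: "lift_action (- \<alpha> *\<^sub>R axis i 1) (-1) \<in> ?S"
    using probe_neq_axis[OF assms(1), of i i]
    by (intro span_base) (simp add: actions_def hard_actions_def hard_groups_def)
  \<comment> \<open>Two parallel covariates from different groups isolate the bias direction.\<close>
  have "lift_action (- \<alpha> *\<^sub>R axis i 1) (-1) + \<alpha> *\<^sub>R lift_action (axis i 1) (?z (axis i 1))
      = (\<alpha> - 1) *\<^sub>R e_last"
    by (auto simp: vec_eq_iff lift_action_def hard_groups_def axis_def split: option.splits)
  then have "(\<alpha> - 1) *\<^sub>R e_last \<in> ?S" by (metis span_add span_scale ax pr)
  then have "(1 / (\<alpha> - 1)) *\<^sub>R (\<alpha> - 1) *\<^sub>R e_last \<in> ?S" by (rule span_scale)
  then have e: "e_last \<in> ?S" using assms by simp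
  have "axis k 1 \<in> ?S" for k
  proof (cases k)
    case None then show ?thesis using e by simp
  next
    case (Some j)
    have "lift_action (axis j 1) (?z (axis j 1)) - ?z (axis j 1) *\<^sub>R e_last \<in> ?S"
      by (intro span_diff span_scale ax e)
    moreover have "lift_action (axis j 1) (?z (axis j 1)) - ?z (axis j 1) *\<^sub>R e_last = axis (Some j) 1"
      by (auto simp: vec_eq_iff lift_action_def axis_def split: option.splits)
    ultimately show ?thesis using Some by simp
  qed
  then have "Basis \<subseteq> ?S" by (auto simp: Basis_vec_def)
  then show "?S = UNIV" by (metis span_Basis span_minimal subspace_span top.extremum_uniqueI)
qed

lemma gam_hard: "gam (hard_parameter i m \<epsilon>) = (\<chi> j. if j = i then m + \<epsilon> else m - \<epsilon>)"
  by (simp add: gam_def hard_parameter_def)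

lemma om_hard: "om (hard_parameter i m \<epsilon>) = - \<epsilon>"
  by (simp add: om_def hard_parameter_def)

text \<open>
  The bias direction is a combination of the lifted actions of \<open>axis i 1\<close> and of the probe with
  coefficients \<open>- \<alpha> / (1 - \<alpha>)\<close> and \<open>- 1 / (1 - \<alpha>)\<close>, and the best design has variance
  \<open>((1 + \<alpha>) / (1 - \<alpha>))\<^sup>2\<close>. The value of \<open>\<alpha>\<close> is the one that makes this equal to \<open>\<kappa>\<close>.
\<close>

lemma hard_correlated:
  fixes i :: "'n::finite" and \<kappa> :: real
  assumes "1 \<le> \<kappa>" and \<alpha>: "\<alpha> = (sqrt \<kappa> - 1) / (sqrt \<kappa> + 1)"
  shows "(hard_actions i \<alpha>, hard_groups i) \<in> correlated_action_sets \<kappa>"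
proof -
  define r where "r = sqrt \<kappa>"
  have r: "1 \<le> r" "r\<^sup>2 = \<kappa>" "0 \<le> r" using assms(1) by (auto simp: r_def)
  have a: "0 \<le> \<alpha>" "\<alpha> < 1" "\<alpha> * (1 + r) = r - 1" using r by (auto simp: \<alpha> r_def[symmetric] divide_simps)
  \<comment> \<open>The dual certificate: its inner product is \<open>- 1\<close> with \<open>axis i 1\<close> and the probe, where both
      coefficients above are negative, and 0 with the other actions.\<close>
  define y :: "real ^ 'n option" where
    "y = (\<chi> k. case k of None \<Rightarrow> r | Some j \<Rightarrow> if j = i then - 1 - r else r)"
  have y: "gam y = (\<chi> j. if j = i then - 1 - r else r)" "om y = r" by (simp_all add: y_def gam_def om_def)
  have "(hard_actions i \<alpha>, hard_groups i) \<in> correlated_action_sets ((y $ None)\<^sup>2)"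
  proof (rule correlated_action_setI[OF action_set_hard])
    fix x assume "x \<in> hard_actions i \<alpha>"
    then consider j where "x = axis j 1" | "x = - \<alpha> *\<^sub>R axis i 1" by (auto simp: hard_actions_def)
    then show "\<bar>lift_action x (hard_groups i x) \<bullet> y\<bar> \<le> 1"
    proof cases
      case 1
      then show ?thesis by (simp add: axis_eq_axis inner_lift_action y inner_axis' hard_groups_def)
    next
      case 2
      then show ?thesis using probe_neq_axis[OF a(1), of i i] a(3)
        by (simp add: inner_lift_action y inner_axis' hard_groups_def algebra_simps)
    qed
  qed (use assms a in auto)
  then show ?thesis using r by (simp add: y_def)
qed

section \<open>Change of measure between bandit problems\<close>

abbreviation history_space :: "(real ^ 'n::finite) set \<Rightarrow> nat \<Rightarrow> 'n history measure" where
  "history_space X t \<equiv> PiM {..<t} (\<lambda>_. count_space X \<Otimes>\<^sub>M borel)"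

definition response_mean :: "(real ^ 'n \<Rightarrow> real) \<Rightarrow> real ^ 'n::finite option \<Rightarrow> real ^ 'n \<Rightarrow> real" where
  "response_mean z \<theta> x = x \<bullet> gam \<theta> + z x * om \<theta>"

lemma run_history_Suc:
  "run_history z \<theta> alg u \<xi> (Suc t) = (run_history z \<theta> alg u \<xi> t)
     (t := (chosen z \<theta> alg u \<xi> t, response_mean z \<theta> (chosen z \<theta> alg u \<xi> t) + \<xi> t))"
  by (simp add: chosen_def Let_def response_mean_def)

lemma run_history_cong:
  "(\<And>s. s < t \<Longrightarrow> \<xi> s = \<xi>' s) \<Longrightarrow> run_history z \<theta> alg u \<xi> t = run_history z \<theta> alg u \<xi>' t"
  by (induction t) (simp_all add: Let_def)

lemma chosen_cong:
  "(\<And>s. s < t \<Longrightarrow> \<xi> s = \<xi>' s) \<Longrightarrow> chosen z \<theta> alg u \<xi> t = chosen z \<theta> alg u \<xi>' t"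
  unfolding chosen_def using run_history_cong by metis

lemma fst_run_history: "s < t \<Longrightarrow> fst (run_history z \<theta> alg u \<xi> t s) = chosen z \<theta> alg u \<xi> s"
  by (induction t) (auto simp: run_history_Suc less_Suc_eq simp del: run_history.simps(2))

lemma prob_space_std_normal: "prob_space std_normal_distribution"
  by (rule prob_space_normal_density) simp

text \<open>
  The one-dimensional Girsanov formula: shifting a standard normal variable by \<open>\<Delta>\<close> amounts to
  reweighting it by \<open>exp (\<Delta> y - \<Delta>\<^sup>2 / 2)\<close>.
\<close>

lemma nn_integral_std_normal_shift:
  fixes g :: "real \<Rightarrow> ennreal"
  assumes [measurable]: "g \<in> borel_measurable borel"
  shows "(\<integral>\<^sup>+y. g (\<Delta> + y) \<partial>std_normal_distribution)
       = (\<integral>\<^sup>+y. g y * ennreal (exp (\<Delta> * y - \<Delta>\<^sup>2 / 2)) \<partial>std_normal_distribution)"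
proof -
  have "(\<integral>\<^sup>+y. g y * ennreal (exp (\<Delta> * y - \<Delta>\<^sup>2 / 2)) \<partial>std_normal_distribution)
      = (\<integral>\<^sup>+y. ennreal (std_normal_density y) * (g y * ennreal (exp (\<Delta> * y - \<Delta>\<^sup>2 / 2))) \<partial>lborel)"
    by (subst nn_integral_density) simp_all
  also have "\<dots> = (\<integral>\<^sup>+y. ennreal (std_normal_density (y - \<Delta>)) * g y \<partial>lborel)"
  proof (intro nn_integral_cong)
    fix y
    have "std_normal_density y * exp (\<Delta> * y - \<Delta>\<^sup>2 / 2) = std_normal_density (y - \<Delta>)"
      by (simp add: std_normal_density_def exp_add[symmetric] power2_eq_square field_simps)
    then show "ennreal (std_normal_density y) * (g y * ennreal (exp (\<Delta> * y - \<Delta>\<^sup>2 / 2)))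
        = ennreal (std_normal_density (y - \<Delta>)) * g y"
      by (metis ennreal_mult' mult.assoc mult.commute normal_density_nonneg)
  qed
  also have "\<dots> = (\<integral>\<^sup>+y. ennreal (std_normal_density y) * g (\<Delta> + y) \<partial>lborel)"
    by (subst nn_integral_real_affine[where c = 1 and t = \<Delta>]) simp_all
  also have "\<dots> = (\<integral>\<^sup>+y. g (\<Delta> + y) \<partial>std_normal_distribution)"
    by (subst nn_integral_density) simp_all
  finally show ?thesis by simp
qed

text \<open>
  The density of the law of the first \<open>t\<close> rounds under \<open>\<theta>'\<close> with respect to that under \<open>\<theta>\<close>,
  written as a function of the seed and of the noise of the problem \<open>\<theta>\<close>.
\<close>

definition likelihood_ratio ::
    "(real ^ 'n \<Rightarrow> real) \<Rightarrow> real ^ 'n::finite option \<Rightarrow> real ^ 'n option \<Rightarrow> 'n policy \<Rightarrow> seed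
      \<Rightarrow> (nat \<Rightarrow> real) \<Rightarrow> nat \<Rightarrow> real" where
  "likelihood_ratio z \<theta> \<theta>' alg u \<xi> t = (\<Prod>s<t.
     let x = chosen z \<theta> alg u \<xi> s; \<Delta> = response_mean z \<theta>' x - response_mean z \<theta> x
     in exp (\<Delta> * \<xi> s - \<Delta>\<^sup>2 / 2))"

lemma likelihood_ratio_nonneg: "0 \<le> likelihood_ratio z \<theta> \<theta>' alg u \<xi> t"
  by (auto simp: likelihood_ratio_def Let_def intro: prod_nonneg)

lemma likelihood_ratio_Suc:
  "likelihood_ratio z \<theta> \<theta>' alg u \<xi> (Suc t) = likelihood_ratio z \<theta> \<theta>' alg u \<xi> t *
     (let x = chosen z \<theta> alg u \<xi> t; \<Delta> = response_mean z \<theta>' x - response_mean z \<theta> x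
      in exp (\<Delta> * \<xi> t - \<Delta>\<^sup>2 / 2))"
  by (simp add: likelihood_ratio_def)

lemma likelihood_ratio_cong:
  assumes "\<And>s. s < t \<Longrightarrow> \<xi> s = \<xi>' s"
  shows "likelihood_ratio z \<theta> \<theta>' alg u \<xi> t = likelihood_ratio z \<theta> \<theta>' alg u \<xi>' t"
  unfolding likelihood_ratio_def
proof (intro prod.cong refl)
  fix s assume "s \<in> {..<t}"
  then have "chosen z \<theta> alg u \<xi> s = chosen z \<theta> alg u \<xi>' s" "\<xi> s = \<xi>' s"
    using assms by (auto intro: chosen_cong)
  then show "(let x = chosen z \<theta> alg u \<xi> s; \<Delta> = response_mean z \<theta>' x - response_mean z \<theta> x
      in exp (\<Delta> * \<xi> s - \<Delta>\<^sup>2 / 2)) =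
    (let x = chosen z \<theta> alg u \<xi>' s; \<Delta> = response_mean z \<theta>' x - response_mean z \<theta> x
      in exp (\<Delta> * \<xi>' s - \<Delta>\<^sup>2 / 2))"
    by (simp only: Let_def)
qed

locale bandit_interaction =
  fixes T :: nat and X :: "(real ^ 'n::finite) set" and z :: "real ^ 'n \<Rightarrow> real"
    and S :: "seed measure" and alg :: "'n policy"
  assumes algorithm: "bandit_algorithm T X S alg"
begin

lemma prob_space_seed: "prob_space S"
  using algorithm by (simp add: bandit_algorithm_def)

lemma measurable_policy:
  "t < T \<Longrightarrow> (\<lambda>(u, h). alg t u h) \<in> measurable (S \<Otimes>\<^sub>M history_space X t) (count_space X)"
  using algorithm by (simp add: bandit_algorithm_def)

text \<open>
  The index set \<open>I\<close> of the noise variables is a parameter because the same interaction is viewed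
  on the noise of the past rounds, where induction is possible, and on the infinite noise sequence,
  on which the regret is defined.
\<close>

lemma measurable_run_history:
  assumes "t \<le> T" "{..<t} \<subseteq> I"
  shows "(\<lambda>(u, \<xi>). run_history z \<theta> alg u \<xi> t)
    \<in> measurable (S \<Otimes>\<^sub>M PiM I (\<lambda>_. std_normal_distribution)) (history_space X t)"
  using assms
proof (induction t)
  case 0
  then show ?case by (simp add: space_PiM)
next
  case (Suc t)
  let ?M = "S \<Otimes>\<^sub>M PiM I (\<lambda>_. std_normal_distribution)"
  have H: "(\<lambda>(u, \<xi>). run_history z \<theta> alg u \<xi> t) \<in> measurable ?M (history_space X t)"
    using Suc by (auto simp: lessThan_Suc)
  then have H': "(\<lambda>w. (fst w, run_history z \<theta> alg (fst w) (snd w) t)) \<in> measurable ?M (S \<Otimes>\<^sub>M history_space X t)"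
    by (intro measurable_Pair) (auto simp: case_prod_beta')
  have C: "(\<lambda>w. chosen z \<theta> alg (fst w) (snd w) t) \<in> measurable ?M (count_space X)"
    using measurable_compose[OF H' measurable_policy] Suc.prems by (simp add: chosen_def)
  have m: "response_mean z \<theta> \<in> measurable (count_space X) borel" by simp
  have e: "(\<lambda>w. snd w t) \<in> measurable ?M borel"
  proof -
    have "(\<lambda>w. snd w t) \<in> measurable ?M std_normal_distribution"
      using Suc.prems by (intro measurable_compose[OF measurable_snd measurable_component_singleton]) auto
    then show ?thesis by simp
  qed
  have "(\<lambda>w. (chosen z \<theta> alg (fst w) (snd w) t,
      response_mean z \<theta> (chosen z \<theta> alg (fst w) (snd w) t) + snd w t)) \<in> measurable ?M (count_space X \<Otimes>\<^sub>M borel)"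
    by (intro measurable_Pair C borel_measurable_add measurable_compose[OF C m] e)
  then have "(\<lambda>w. (run_history z \<theta> alg (fst w) (snd w) t)(t := (chosen z \<theta> alg (fst w) (snd w) t,
      response_mean z \<theta> (chosen z \<theta> alg (fst w) (snd w) t) + snd w t)))
      \<in> measurable ?M (PiM (insert t {..<t}) (\<lambda>_. count_space X \<Otimes>\<^sub>M borel))"
    using measurable_compose[OF measurable_Pair[OF H[unfolded case_prod_beta']]
        measurable_add_dim[of t "{..<t}" "\<lambda>_. count_space X \<Otimes>\<^sub>M borel"]] by simp
  then show ?case
    unfolding lessThan_Suc run_history_Suc case_prod_beta' .
qed

lemma measurable_chosen:
  assumes "t < T" "{..<t} \<subseteq> I"
  shows "(\<lambda>(u, \<xi>). chosen z \<theta> alg u \<xi> t)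
    \<in> measurable (S \<Otimes>\<^sub>M PiM I (\<lambda>_. std_normal_distribution)) (count_space X)"
proof -
  let ?M = "S \<Otimes>\<^sub>M PiM I (\<lambda>_. std_normal_distribution)"
  have "(\<lambda>w. (fst w, run_history z \<theta> alg (fst w) (snd w) t)) \<in> measurable ?M (S \<Otimes>\<^sub>M history_space X t)"
    using measurable_run_history[of t I] assms by (intro measurable_Pair) (auto simp: case_prod_beta')
  from measurable_compose[OF this measurable_policy[OF assms(1)]]
  show ?thesis by (simp add: chosen_def case_prod_beta')
qed

lemma measurable_likelihood_ratio:
  assumes "t \<le> T" "{..<t} \<subseteq> I"
  shows "(\<lambda>(u, \<xi>). likelihood_ratio z \<theta> \<theta>' alg u \<xi> t)
    \<in> borel_measurable (S \<Otimes>\<^sub>M PiM I (\<lambda>_. std_normal_distribution))"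
  unfolding likelihood_ratio_def case_prod_beta' Let_def
proof (intro borel_measurable_prod)
  fix s assume "s \<in> {..<t}"
  let ?M = "S \<Otimes>\<^sub>M PiM I (\<lambda>_. std_normal_distribution)"
  define D where "D = (\<lambda>x. response_mean z \<theta>' x - response_mean z \<theta> x)"
  have c: "(\<lambda>w. chosen z \<theta> alg (fst w) (snd w) s) \<in> measurable ?M (count_space X)"
    using measurable_chosen[of s I \<theta>] assms \<open>s \<in> {..<t}\<close> by (auto simp: case_prod_beta' subset_eq)
  have "D \<in> measurable (count_space X) borel" by simp
  from measurable_compose[OF c this] have [measurable]: "(\<lambda>w. D (chosen z \<theta> alg (fst w) (snd w) s)) \<in> borel_measurable ?M" .
  have "(\<lambda>w. snd w s) \<in> measurable ?M std_normal_distribution"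
    using assms \<open>s \<in> {..<t}\<close> by (intro measurable_compose[OF measurable_snd measurable_component_singleton]) auto
  then have [measurable]: "(\<lambda>w. snd w s) \<in> measurable ?M borel" by simp
  have "(\<lambda>w. exp (D (chosen z \<theta> alg (fst w) (snd w) s) * snd w s - (D (chosen z \<theta> alg (fst w) (snd w) s))\<^sup>2 / 2))
      \<in> borel_measurable ?M"
    by measurable
  then show "(\<lambda>w. exp ((response_mean z \<theta>' (chosen z \<theta> alg (fst w) (snd w) s)
        - response_mean z \<theta> (chosen z \<theta> alg (fst w) (snd w) s)) * snd w s
      - (response_mean z \<theta>' (chosen z \<theta> alg (fst w) (snd w) s)
        - response_mean z \<theta> (chosen z \<theta> alg (fst w) (snd w) s))\<^sup>2 / 2)) \<in> borel_measurable ?M"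
    unfolding D_def .
qed

text \<open>
  Once the seed is fixed, the algorithm is deterministic and the statement follows by induction on
  the number of rounds. Integrating out the last noise variable leaves a function \<open>G\<close> of the
  history of the first \<open>t\<close> rounds, to which the induction hypothesis applies; the last choice depends
  on that history only, so within this integral the last shift is a constant and the one-dimensional
  formula produces the last factor of the likelihood ratio.
\<close>

lemma change_of_measure_fixed_seed:
  assumes u: "u \<in> space S" and "t \<le> T" "F \<in> borel_measurable (history_space X t)"
  shows "(\<integral>\<^sup>+\<xi>. F (run_history z \<theta>' alg u \<xi> t) \<partial>PiM {..<t} (\<lambda>_. std_normal_distribution))
       = (\<integral>\<^sup>+\<xi>. F (run_history z \<theta> alg u \<xi> t) * ennreal (likelihood_ratio z \<theta> \<theta>' alg u \<xi> t)
            \<partial>PiM {..<t} (\<lambda>_. std_normal_distribution))"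
  using assms(2,3)
proof (induction t arbitrary: F)
  case 0
  then show ?case by (simp add: likelihood_ratio_def)
next
  case (Suc t)
  let ?N = "std_normal_distribution"
  interpret N: prob_space ?N by (rule prob_space_std_normal)
  interpret P: product_prob_space "\<lambda>_::nat. ?N" by unfold_locales
  define D where "D = (\<lambda>x. response_mean z \<theta>' x - response_mean z \<theta> x)"
  define K where "K = (\<lambda>\<theta> h y. F (h(t := (alg t u h, response_mean z \<theta> (alg t u h) + y))))"
  have tT: "t < T" using Suc.prems by simp
  have pol: "alg t u \<in> measurable (history_space X t) (count_space X)"
    using measurable_compose[OF measurable_Pair1'[OF u] measurable_policy[OF tT]] by simp
  have K: "(\<lambda>(h, y). K \<eta> h y) \<in> borel_measurable (history_space X t \<Otimes>\<^sub>M borel)" for \<eta>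
  proof -
    let ?M = "history_space X t \<Otimes>\<^sub>M (borel :: real measure)"
    have C: "(\<lambda>w. alg t u (fst w)) \<in> measurable ?M (count_space X)"
      by (rule measurable_compose[OF measurable_fst pol])
    have m: "response_mean z \<eta> \<in> measurable (count_space X) borel" by simp
    have "(\<lambda>w. (alg t u (fst w), response_mean z \<eta> (alg t u (fst w)) + snd w)) \<in> measurable ?M (count_space X \<Otimes>\<^sub>M borel)"
      by (intro measurable_Pair C borel_measurable_add measurable_compose[OF C m] measurable_snd)
    then have "(\<lambda>w. (fst w)(t := (alg t u (fst w), response_mean z \<eta> (alg t u (fst w)) + snd w)))
        \<in> measurable ?M (PiM (insert t {..<t}) (\<lambda>_. count_space X \<Otimes>\<^sub>M borel))"
      using measurable_compose[OF measurable_Pair[OF measurable_fst]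
        measurable_add_dim[of t "{..<t}" "\<lambda>_. count_space X \<Otimes>\<^sub>M borel"]] by simp
    from measurable_compose[OF this[folded lessThan_Suc] Suc.prems(2)]
    show ?thesis unfolding K_def case_prod_beta' .
  qed
  define G where "G = (\<lambda>h. \<integral>\<^sup>+y. K \<theta>' h y \<partial>?N)"
  have G: "G \<in> borel_measurable (history_space X t)"
  proof -
    have "(\<lambda>(h, y). K \<theta>' h y) \<in> borel_measurable (history_space X t \<Otimes>\<^sub>M ?N)"
      using K by (subst measurable_cong_sets[OF sets_pair_measure_cong[OF refl] refl]) auto
    then show ?thesis unfolding G_def by (rule N.borel_measurable_nn_integral)
  qed
  have space_H: "run_history z \<theta> alg u \<xi> t \<in> space (history_space X t)"
    if "\<xi> \<in> space (PiM {..<t} (\<lambda>_. ?N))" for \<xi>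
    using measurable_space[OF measurable_run_history[of t "{..<t}" \<theta>], of "(u, \<xi>)"] tT u that
    by (simp add: space_pair_measure)
  \<comment> \<open>The last noise variable affects neither the earlier history nor the earlier likelihood ratio.\<close>
  have same: "run_history z \<eta> alg u (\<xi>(t := y)) t = run_history z \<eta> alg u \<xi> t" for \<eta> \<xi> y
    by (rule run_history_cong) simp
  have H_upd: "F (run_history z \<eta> alg u (\<xi>(t := y)) (Suc t)) = K \<eta> (run_history z \<eta> alg u \<xi> t) y" for \<eta> \<xi> y
    by (simp only: run_history_Suc K_def chosen_def same fun_upd_same)
  have Z_cong: "likelihood_ratio z \<theta> \<theta>' alg u (\<xi>(t := y)) t = likelihood_ratio z \<theta> \<theta>' alg u \<xi> t" for \<xi> y
    by (rule likelihood_ratio_cong) simp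
  have Z_upd: "likelihood_ratio z \<theta> \<theta>' alg u (\<xi>(t := y)) (Suc t)
      = likelihood_ratio z \<theta> \<theta>' alg u \<xi> t
        * exp (D (alg t u (run_history z \<theta> alg u \<xi> t)) * y - (D (alg t u (run_history z \<theta> alg u \<xi> t)))\<^sup>2 / 2)" for \<xi> y
    by (simp only: likelihood_ratio_Suc Z_cong D_def Let_def chosen_def same fun_upd_same)
  have sec: "(\<lambda>\<xi>. f (u, \<xi>)) \<in> borel_measurable (PiM {..<Suc t} (\<lambda>_. ?N))"
    if "f \<in> borel_measurable (S \<Otimes>\<^sub>M PiM {..<Suc t} (\<lambda>_. ?N))" for f :: "_ \<Rightarrow> ennreal"
    using measurable_compose[OF measurable_Pair1'[OF u] that] .
  have mH: "(\<lambda>(u, \<xi>). F (run_history z \<eta> alg u \<xi> (Suc t))) \<in> borel_measurable (S \<Otimes>\<^sub>M PiM {..<Suc t} (\<lambda>_. ?N))" for \<eta>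
    using measurable_compose[OF measurable_run_history[OF Suc.prems(1) order_refl, of \<eta>] Suc.prems(2)]
    by (simp add: case_prod_beta')
  have mZ: "(\<lambda>(u, \<xi>). F (run_history z \<theta> alg u \<xi> (Suc t)) * ennreal (likelihood_ratio z \<theta> \<theta>' alg u \<xi> (Suc t)))
      \<in> borel_measurable (S \<Otimes>\<^sub>M PiM {..<Suc t} (\<lambda>_. ?N))"
    using borel_measurable_times_ennreal[OF mH[of \<theta>] measurable_compose[OF measurable_likelihood_ratio[OF Suc.prems(1) order_refl, of \<theta> \<theta>'] measurable_ennreal]]
    by (simp add: case_prod_beta')
  have "(\<integral>\<^sup>+\<xi>. F (run_history z \<theta>' alg u \<xi> (Suc t)) \<partial>PiM {..<Suc t} (\<lambda>_. ?N))
      = (\<integral>\<^sup>+\<xi>. \<integral>\<^sup>+y. F (run_history z \<theta>' alg u (\<xi>(t := y)) (Suc t)) \<partial>?N \<partial>PiM {..<t} (\<lambda>_. ?N))"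
    using sec[OF mH[of \<theta>']] unfolding lessThan_Suc by (subst P.product_nn_integral_insert) auto
  also have "\<dots> = (\<integral>\<^sup>+\<xi>. G (run_history z \<theta>' alg u \<xi> t) \<partial>PiM {..<t} (\<lambda>_. ?N))"
    by (simp only: H_upd G_def)
  also have "\<dots> = (\<integral>\<^sup>+\<xi>. G (run_history z \<theta> alg u \<xi> t) * ennreal (likelihood_ratio z \<theta> \<theta>' alg u \<xi> t) \<partial>PiM {..<t} (\<lambda>_. ?N))"
    using tT by (intro Suc.IH G) simp
  also have "\<dots> = (\<integral>\<^sup>+\<xi>. \<integral>\<^sup>+y. F (run_history z \<theta> alg u (\<xi>(t := y)) (Suc t))
      * ennreal (likelihood_ratio z \<theta> \<theta>' alg u (\<xi>(t := y)) (Suc t)) \<partial>?N \<partial>PiM {..<t} (\<lambda>_. ?N))"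
  proof (intro nn_integral_cong)
    fix \<xi> assume \<xi>: "\<xi> \<in> space (PiM {..<t} (\<lambda>_. ?N))"
    let ?h = "run_history z \<theta> alg u \<xi> t" and ?Z = "likelihood_ratio z \<theta> \<theta>' alg u \<xi> t"
    let ?D = "D (alg t u ?h)"
    have Kh: "K \<theta> ?h \<in> borel_measurable borel"
      using measurable_compose[OF measurable_Pair1'[OF space_H[OF \<xi>]] K[of \<theta>]] by simp
    have "G ?h = (\<integral>\<^sup>+y. K \<theta> ?h (?D + y) \<partial>?N)"
      by (simp add: G_def K_def D_def algebra_simps)
    also have "\<dots> = (\<integral>\<^sup>+y. K \<theta> ?h y * ennreal (exp (?D * y - ?D\<^sup>2 / 2)) \<partial>?N)"
      by (rule nn_integral_std_normal_shift[OF Kh])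
    finally have "G ?h * ennreal ?Z = (\<integral>\<^sup>+y. K \<theta> ?h y * ennreal (exp (?D * y - ?D\<^sup>2 / 2)) * ennreal ?Z \<partial>?N)"
      using Kh by (subst nn_integral_multc) simp_all
    then show "G ?h * ennreal ?Z = (\<integral>\<^sup>+y. F (run_history z \<theta> alg u (\<xi>(t := y)) (Suc t))
        * ennreal (likelihood_ratio z \<theta> \<theta>' alg u (\<xi>(t := y)) (Suc t)) \<partial>?N)"
      unfolding H_upd Z_upd by (simp add: ennreal_mult likelihood_ratio_nonneg ac_simps)
  qed
  also have "\<dots> = (\<integral>\<^sup>+\<xi>. F (run_history z \<theta> alg u \<xi> (Suc t)) * ennreal (likelihood_ratio z \<theta> \<theta>' alg u \<xi> (Suc t)) \<partial>PiM {..<Suc t} (\<lambda>_. ?N))"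
    using sec[OF mZ] unfolding lessThan_Suc by (subst P.product_nn_integral_insert) auto
  finally show ?case .
qed


text \<open>
  The two laws are compared on the infinite noise space of one problem, so that all problems can be
  compared with the same reference. Only the first \<open>T\<close> noise variables matter, which reduces the
  claim to the finite product for each seed.
\<close>

lemma change_of_measure:
  fixes F :: "'n history \<Rightarrow> ennreal"
  assumes F: "F \<in> borel_measurable (history_space X T)"
  shows "(\<integral>\<^sup>+(u, \<xi>). F (run_history z \<theta>' alg u \<xi> T) \<partial>(S \<Otimes>\<^sub>M noise))
       = (\<integral>\<^sup>+(u, \<xi>). F (run_history z \<theta> alg u \<xi> T) * ennreal (likelihood_ratio z \<theta> \<theta>' alg u \<xi> T)
            \<partial>(S \<Otimes>\<^sub>M noise))"
proof -
  let ?N = "std_normal_distribution"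
  interpret N: prob_space ?N by (rule prob_space_std_normal)
  interpret P: product_prob_space "\<lambda>_::nat. ?N" UNIV by unfold_locales
  have U: "sigma_finite_measure (PiM UNIV (\<lambda>_::nat. ?N))"
    by (intro prob_space_imp_sigma_finite prob_space_PiM prob_space_std_normal)
  let ?Z = "likelihood_ratio z \<theta> \<theta>' alg"
  have mH: "(\<lambda>(u, \<xi>). F (run_history z \<eta> alg u \<xi> T)) \<in> borel_measurable (S \<Otimes>\<^sub>M PiM I (\<lambda>_. ?N))"
    if "{..<T} \<subseteq> I" for \<eta> I
    using measurable_compose[OF measurable_run_history[OF order_refl that, of \<eta>] F] by (simp add: case_prod_beta')
  have mZ: "(\<lambda>(u, \<xi>). F (run_history z \<theta> alg u \<xi> T) * ennreal (?Z u \<xi> T)) \<in> borel_measurable (S \<Otimes>\<^sub>M PiM I (\<lambda>_. ?N))"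
    if "{..<T} \<subseteq> I" for I
    using borel_measurable_times_ennreal[OF mH[OF that, of \<theta>]
        measurable_compose[OF measurable_likelihood_ratio[OF order_refl that, of \<theta> \<theta>'] measurable_ennreal]]
    by (simp add: case_prod_beta')
  have res: "(\<integral>\<^sup>+\<xi>. f (u, \<xi>) \<partial>PiM UNIV (\<lambda>_. ?N)) = (\<integral>\<^sup>+\<xi>. f (u, \<xi>) \<partial>PiM {..<T} (\<lambda>_. ?N))"
    if f: "f \<in> borel_measurable (S \<Otimes>\<^sub>M PiM {..<T} (\<lambda>_. ?N))" and u: "u \<in> space S"
      and cong: "\<And>\<xi>. f (u, \<xi>) = f (u, restrict \<xi> {..<T})" for f :: "_ \<Rightarrow> ennreal" and u
  proof -
    have "(\<integral>\<^sup>+\<xi>. f (u, \<xi>) \<partial>PiM {..<T} (\<lambda>_. ?N))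
        = (\<integral>\<^sup>+\<xi>. f (u, \<xi>) \<partial>distr (PiM UNIV (\<lambda>_. ?N)) (PiM {..<T} (\<lambda>_. ?N)) (\<lambda>\<xi>. restrict \<xi> {..<T}))"
      by (simp only: P.distr_PiM_restrict_finite[OF finite_lessThan subset_UNIV])
    also have "\<dots> = (\<integral>\<^sup>+\<xi>. f (u, restrict \<xi> {..<T}) \<partial>PiM UNIV (\<lambda>_. ?N))"
      using measurable_compose[OF measurable_Pair1'[OF u] f]
      by (intro nn_integral_distr measurable_restrict_subset) simp_all
    finally show ?thesis using cong by simp
  qed
  have cH: "run_history z \<eta> alg u (restrict \<xi> {..<T}) T = run_history z \<eta> alg u \<xi> T" for \<eta> u \<xi>
    by (rule run_history_cong) simp
  have cZ: "?Z u (restrict \<xi> {..<T}) T = ?Z u \<xi> T" for u \<xi>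
    by (rule likelihood_ratio_cong) simp
  have "(\<integral>\<^sup>+(u, \<xi>). F (run_history z \<theta>' alg u \<xi> T) \<partial>(S \<Otimes>\<^sub>M noise))
      = (\<integral>\<^sup>+u. \<integral>\<^sup>+\<xi>. F (run_history z \<theta>' alg u \<xi> T) \<partial>PiM UNIV (\<lambda>_. ?N) \<partial>S)"
    using sigma_finite_measure.nn_integral_fst[OF U mH[OF subset_UNIV, of \<theta>']] by (simp add: noise_def)
  also have "\<dots> = (\<integral>\<^sup>+u. \<integral>\<^sup>+\<xi>. F (run_history z \<theta> alg u \<xi> T) * ennreal (?Z u \<xi> T) \<partial>PiM UNIV (\<lambda>_. ?N) \<partial>S)"
  proof (rule nn_integral_cong)
    fix u assume u: "u \<in> space S"
    show "(\<integral>\<^sup>+\<xi>. F (run_history z \<theta>' alg u \<xi> T) \<partial>PiM UNIV (\<lambda>_. ?N))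
        = (\<integral>\<^sup>+\<xi>. F (run_history z \<theta> alg u \<xi> T) * ennreal (?Z u \<xi> T) \<partial>PiM UNIV (\<lambda>_. ?N))"
      using res[OF mH[OF order_refl, of \<theta>'] u] res[OF mZ[OF order_refl] u]
        change_of_measure_fixed_seed[OF u order_refl F, of \<theta>' \<theta>] by (simp add: cH cZ)
  qed
  also have "\<dots> = (\<integral>\<^sup>+(u, \<xi>). F (run_history z \<theta> alg u \<xi> T) * ennreal (?Z u \<xi> T) \<partial>(S \<Otimes>\<^sub>M noise))"
    using sigma_finite_measure.nn_integral_fst[OF U mZ[OF subset_UNIV]] by (simp add: noise_def)
  finally show ?thesis .
qed

end

section \<open>Three problems distinguished by one action\<close>

definition gap :: "(real ^ 'n::finite) set \<Rightarrow> real ^ 'n option \<Rightarrow> real ^ 'n \<Rightarrow> real" where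
  "gap X \<theta> x = (arg_max_on (\<lambda>x. x \<bullet> gam \<theta>) X - x) \<bullet> gam \<theta>"

text \<open>
  The regret refers to \<open>arg_max_on\<close>, which is an unspecified value unless the maximum is attained;
  finiteness of \<open>X\<close> provides this.
\<close>

lemma gap_ge:
  assumes X: "finite X" and "x' \<in> X"
  shows "(x' - x) \<bullet> gam \<theta> \<le> gap X \<theta> x"
proof -
  let ?f = "\<lambda>x. x \<bullet> gam \<theta>"
  have "Max (?f ` X) \<in> ?f ` X" using X \<open>x' \<in> X\<close> by (intro Max_in) auto
  then obtain m where "m \<in> X" "?f m = Max (?f ` X)" by auto
  then have "is_arg_max ?f (\<lambda>x. x \<in> X) m" using X by (auto simp: is_arg_max_linorder)
  then have "is_arg_max ?f (\<lambda>x. x \<in> X) (arg_max_on ?f X)"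
    unfolding arg_max_on_def arg_max_def by (rule someI)
  then show ?thesis using \<open>x' \<in> X\<close> by (simp add: gap_def is_arg_max_linorder inner_diff_left)
qed

text \<open>
  By the inequality of arithmetic and geometric means \<open>s \<le> 2 sqrt (x * (y / 4)) \<le> x + y / 4\<close>, for
  \<open>x\<close> the smaller of \<open>a\<close> and \<open>b\<close>. For likelihood ratios this bounds the error of testing from below
  by the Hellinger affinity.
\<close>

lemma sqrt_product_le_min:
  fixes a b s :: real
  assumes "0 \<le> a" "0 \<le> b" "s\<^sup>2 = a * b"
  shows "s - (a + b) / 4 \<le> min a b"
proof -
  have *: "s \<le> x + y / 4" if "0 \<le> x" "0 \<le> y" "s\<^sup>2 = x * y" for x y :: real
  proof (rule power2_le_imp_le)
    have "(x + y / 4)\<^sup>2 = x * y + (x - y / 4)\<^sup>2" by (simp add: power2_eq_square algebra_simps)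
    then show "s\<^sup>2 \<le> (x + y / 4)\<^sup>2" using that by simp
  qed (use that in simp)
  from *[of a b] *[of b a] assms show ?thesis by (simp add: min_def mult.commute add_divide_distrib)
qed

context bandit_interaction
begin

text \<open>
  Boundedness of \<open>F\<close> gives integrability under \<open>\<theta>'\<close>; that of the reweighted function, whose
  second factor is unbounded, then follows because the two integrals agree.
\<close>

lemma integral_change_of_measure:
  fixes F :: "'n history \<Rightarrow> real"
  assumes F: "F \<in> borel_measurable (history_space X T)"
    and bnd: "\<And>h. h \<in> space (history_space X T) \<Longrightarrow> 0 \<le> F h \<and> F h \<le> B"
  shows "integrable (S \<Otimes>\<^sub>M noise) (\<lambda>(u, \<xi>). F (run_history z \<theta>' alg u \<xi> T))"
    and "integrable (S \<Otimes>\<^sub>M noise)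
          (\<lambda>(u, \<xi>). F (run_history z \<theta> alg u \<xi> T) * likelihood_ratio z \<theta> \<theta>' alg u \<xi> T)"
    and "(\<integral>(u, \<xi>). F (run_history z \<theta>' alg u \<xi> T) \<partial>(S \<Otimes>\<^sub>M noise))
       = (\<integral>(u, \<xi>). F (run_history z \<theta> alg u \<xi> T) * likelihood_ratio z \<theta> \<theta>' alg u \<xi> T \<partial>(S \<Otimes>\<^sub>M noise))"
proof -
  let ?M = "S \<Otimes>\<^sub>M noise"
  interpret S: prob_space S by (rule prob_space_seed)
  interpret U: prob_space noise unfolding noise_def by (rule prob_space_PiM) (rule prob_space_std_normal)
  interpret M: pair_prob_space S noise ..
  have mR: "(\<lambda>(u, \<xi>). run_history z \<eta> alg u \<xi> T) \<in> measurable ?M (history_space X T)" for \<eta>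
    unfolding noise_def by (rule measurable_run_history) simp_all
  have mF: "(\<lambda>w. F (run_history z \<eta> alg (fst w) (snd w) T)) \<in> borel_measurable ?M" for \<eta>
    using measurable_compose[OF mR[of \<eta>] F] by (simp add: case_prod_beta')
  have mZ: "(\<lambda>w. likelihood_ratio z \<theta> \<theta>' alg (fst w) (snd w) T) \<in> borel_measurable ?M"
    using measurable_likelihood_ratio[OF order_refl subset_UNIV, of \<theta> \<theta>'] by (simp add: case_prod_beta' noise_def)
  have b: "0 \<le> F (run_history z \<eta> alg (fst w) (snd w) T) \<and> F (run_history z \<eta> alg (fst w) (snd w) T) \<le> B"
    if "w \<in> space ?M" for w \<eta>
    using measurable_space[OF mR that, of \<eta>] by (intro bnd) (simp add: case_prod_beta')
  show int: "integrable ?M (\<lambda>(u, \<xi>). F (run_history z \<theta>' alg u \<xi> T))"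
    unfolding case_prod_beta' using mF b
    by (intro M.integrable_const_bound[where B = B] AE_I2) auto
  have eq: "(\<integral>\<^sup>+w. ennreal (F (run_history z \<theta>' alg (fst w) (snd w) T)) \<partial>?M)
      = (\<integral>\<^sup>+w. ennreal (F (run_history z \<theta> alg (fst w) (snd w) T) * likelihood_ratio z \<theta> \<theta>' alg (fst w) (snd w) T) \<partial>?M)"
    using change_of_measure[OF measurable_compose[OF F measurable_ennreal], of \<theta>' \<theta>]
    by (simp add: case_prod_beta' ennreal_mult'' likelihood_ratio_nonneg)
  have nn: "AE w in ?M. 0 \<le> F (run_history z \<theta> alg (fst w) (snd w) T) * likelihood_ratio z \<theta> \<theta>' alg (fst w) (snd w) T"
    using b by (intro AE_I2 mult_nonneg_nonneg likelihood_ratio_nonneg) auto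
  have mFZ: "(\<lambda>w. F (run_history z \<theta> alg (fst w) (snd w) T) * likelihood_ratio z \<theta> \<theta>' alg (fst w) (snd w) T) \<in> borel_measurable ?M"
    by (intro borel_measurable_times mF mZ)
  have fin: "(\<integral>\<^sup>+w. ennreal (F (run_history z \<theta>' alg (fst w) (snd w) T)) \<partial>?M) < \<infinity>"
    using int b by (subst nn_integral_eq_integral) (auto simp: case_prod_beta' intro!: AE_I2)
  show "integrable ?M (\<lambda>(u, \<xi>). F (run_history z \<theta> alg u \<xi> T) * likelihood_ratio z \<theta> \<theta>' alg u \<xi> T)"
    unfolding case_prod_beta' using fin by (intro integrableI_nonneg mFZ nn) (simp add: eq)
  show "(\<integral>(u, \<xi>). F (run_history z \<theta>' alg u \<xi> T) \<partial>?M)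
      = (\<integral>(u, \<xi>). F (run_history z \<theta> alg u \<xi> T) * likelihood_ratio z \<theta> \<theta>' alg u \<xi> T \<partial>?M)"
    unfolding case_prod_beta'
    using b by (subst (1 2) integral_eq_nn_integral) (auto simp: eq nn mF mFZ intro!: AE_I2)
qed

text \<open>
  Only the action \<open>p\<close> distinguishes the three problems, and it shifts the mean by \<open>D\<close> and \<open>- D\<close>
  away from the reference problem \<open>\<theta>\<^sub>0\<close>. Let \<open>N\<close> be the number of times it is played, and \<open>Z\<^sub>1\<close>,
  \<open>Z\<^sub>2\<close> the likelihood ratios with respect to \<open>\<theta>\<^sub>0\<close>. In the product \<open>Z\<^sub>1 Z\<^sub>2\<close> the noise terms cancel,
  and \<open>sqrt (Z\<^sub>1 Z\<^sub>2) = exp (- D\<^sup>2 N / 2) \<ge> 1 - D\<^sup>2 N / 2\<close>.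

  Every choice costs at least \<open>c\<close> in one of the problems \<open>\<theta>\<^sub>1\<close>, \<open>\<theta>\<^sub>2\<close>, so the sum of their regrets
  is at least \<open>c T\<close> times the expectation of \<open>min Z\<^sub>1 Z\<^sub>2 \<ge> sqrt (Z\<^sub>1 Z\<^sub>2) - (Z\<^sub>1 + Z\<^sub>2) / 4\<close> under
  \<open>\<theta>\<^sub>0\<close>. As likelihood ratios have expectation 1, this is at least \<open>1 / 2\<close> minus \<open>D\<^sup>2 / 2\<close> times
  the expectation of \<open>N\<close>, and \<open>c\<^sub>0 N\<close> is paid for by the regret under \<open>\<theta>\<^sub>0\<close>.
\<close>

lemma three_point_bound:
  fixes \<theta>\<^sub>0 \<theta>\<^sub>1 \<theta>\<^sub>2 :: "real ^ 'n option" and p :: "real ^ 'n"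
  assumes X: "finite X" and c: "0 \<le> c" and c\<^sub>0: "0 < c\<^sub>0"
    and probe: "c\<^sub>0 \<le> gap X \<theta>\<^sub>0 p"
    and means: "\<And>x. x \<in> X \<Longrightarrow> response_mean z \<theta>\<^sub>1 x - response_mean z \<theta>\<^sub>0 x = (if x = p then D else 0)"
      "\<And>x. x \<in> X \<Longrightarrow> response_mean z \<theta>\<^sub>2 x - response_mean z \<theta>\<^sub>0 x = (if x = p then - D else 0)"
    and conflict: "\<And>x. x \<in> X \<Longrightarrow> c \<le> gap X \<theta>\<^sub>1 x \<or> c \<le> gap X \<theta>\<^sub>2 x"
  shows "c * real T * (1 / 2 - D\<^sup>2 / (2 * c\<^sub>0) * regret T X z S alg \<theta>\<^sub>0)
      \<le> regret T X z S alg \<theta>\<^sub>1 + regret T X z S alg \<theta>\<^sub>2"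
proof -
  let ?M = "S \<Otimes>\<^sub>M noise"
  interpret S: prob_space S by (rule prob_space_seed)
  interpret U: prob_space noise unfolding noise_def by (rule prob_space_PiM) (rule prob_space_std_normal)
  interpret M: pair_prob_space S noise ..
  define R where "R = (\<lambda>\<theta> h. \<Sum>t<T. gap X \<theta> (fst (h t :: (real ^ 'n) \<times> real)))"
  define N where "N = (\<lambda>h. \<Sum>t<T. if fst (h t :: (real ^ 'n) \<times> real) = p then 1 else 0 :: real)"
  define H where "H = (\<lambda>w. run_history z \<theta>\<^sub>0 alg (fst w) (snd w) T)"
  define Z where "Z = (\<lambda>\<theta> w. likelihood_ratio z \<theta>\<^sub>0 \<theta> alg (fst w) (snd w) T)"
  have gap0: "0 \<le> gap X \<theta> x" if "x \<in> X" for x \<theta> using gap_ge[OF X that, of x \<theta>] by simp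
  have sp: "fst (h t) \<in> X" if "h \<in> space (history_space X T)" "t < T" for h t
    using that by (auto simp: space_PiM PiE_def Pi_def space_pair_measure)
  have msum: "(\<lambda>h. \<Sum>t<T. f (fst (h t))) \<in> borel_measurable (history_space X T)" for f :: "real ^ 'n \<Rightarrow> real"
  proof (intro borel_measurable_sum)
    fix t assume "t \<in> {..<T}"
    then have "(\<lambda>h. h t) \<in> measurable (history_space X T) (count_space X \<Otimes>\<^sub>M borel)"
      by (rule measurable_component_singleton)
    from measurable_compose[OF this measurable_fst]
    show "(\<lambda>h. f (fst (h t))) \<in> borel_measurable (history_space X T)"
      by (rule measurable_compose) simp
  qed
  have bsum: "0 \<le> (\<Sum>t<T. f (fst (h t))) \<and> (\<Sum>t<T. f (fst (h t))) \<le> real T * sum f X"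
    if "h \<in> space (history_space X T)" "\<And>x. x \<in> X \<Longrightarrow> 0 \<le> f x" for h :: "'n history" and f :: "real ^ 'n \<Rightarrow> real"
  proof
    show "0 \<le> (\<Sum>t<T. f (fst (h t)))" using that sp by (intro sum_nonneg) auto
    have "(\<Sum>t<T. f (fst (h t))) \<le> (\<Sum>t<T. sum f X)"
      using that sp[OF that(1)] X by (intro sum_mono member_le_sum) auto
    then show "(\<Sum>t<T. f (fst (h t))) \<le> real T * sum f X" by simp
  qed
  have reg: "regret T X z S alg \<theta> = (\<integral>(u, \<xi>). R \<theta> (run_history z \<theta> alg u \<xi> T) \<partial>?M)" for \<theta>
    unfolding regret_def Let_def R_def gap_def
    by (intro Bochner_Integration.integral_cong refl) (auto simp: fst_run_history)
  have Rm: "R \<theta> \<in> borel_measurable (history_space X T)" for \<theta> unfolding R_def by (rule msum)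
  have Rb: "0 \<le> R \<theta> h \<and> R \<theta> h \<le> real T * sum (gap X \<theta>) X" if "h \<in> space (history_space X T)" for \<theta> h
    unfolding R_def using that gap0 by (rule bsum)
  have regZ: "regret T X z S alg \<theta> = (\<integral>w. R \<theta> (H w) * Z \<theta> w \<partial>?M)" for \<theta>
    using integral_change_of_measure(3)[OF Rm Rb, of \<theta> \<theta> \<theta>\<^sub>0] by (simp add: reg H_def Z_def case_prod_beta')
  have intRZ: "integrable ?M (\<lambda>w. R \<theta> (H w) * Z \<theta> w)" for \<theta>
    using integral_change_of_measure(2)[OF Rm Rb, of \<theta> \<theta>\<^sub>0 \<theta>] by (simp add: H_def Z_def case_prod_beta')
  have intR: "integrable ?M (\<lambda>w. R \<theta>\<^sub>0 (H w))" and reg0: "regret T X z S alg \<theta>\<^sub>0 = (\<integral>w. R \<theta>\<^sub>0 (H w) \<partial>?M)"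
    using integral_change_of_measure(1)[OF Rm Rb, of \<theta>\<^sub>0 \<theta>\<^sub>0] by (simp_all add: reg H_def case_prod_beta')
  have Nm: "N \<in> borel_measurable (history_space X T)" unfolding N_def by (rule msum)
  have Nb: "0 \<le> N h \<and> N h \<le> real T * (\<Sum>x\<in>X. if x = p then 1 else 0)" if "h \<in> space (history_space X T)" for h
    unfolding N_def using that by (rule bsum) simp
  have intN: "integrable ?M (\<lambda>w. N (H w))"
    using integral_change_of_measure(1)[OF Nm Nb, of \<theta>\<^sub>0] by (simp add: H_def case_prod_beta')
  have intZ: "integrable ?M (Z \<theta>)" and Z1: "(\<integral>w. Z \<theta> w \<partial>?M) = 1" for \<theta>
    using integral_change_of_measure(2)[of "\<lambda>_. 1" 1 \<theta>\<^sub>0 \<theta>] integral_change_of_measure(3)[of "\<lambda>_. 1" 1 \<theta> \<theta>\<^sub>0]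
    by (simp_all add: Z_def case_prod_beta' M.prob_space)
  have inX: "chosen z \<theta>\<^sub>0 alg (fst w) (snd w) t \<in> X" if "w \<in> space ?M" "t < T" for w t
    using measurable_space[OF measurable_chosen[OF that(2) subset_UNIV, of \<theta>\<^sub>0], of w] that(1)
    by (simp add: case_prod_beta' noise_def)
  have fstH: "fst (H w t) = chosen z \<theta>\<^sub>0 alg (fst w) (snd w) t" if "t < T" for w t
    using that by (simp add: H_def fst_run_history)
  have ZZ: "Z \<theta>\<^sub>1 w * Z \<theta>\<^sub>2 w = (exp (- D\<^sup>2 / 2 * N (H w)))\<^sup>2" if w: "w \<in> space ?M" for w
  proof -
    have "Z \<theta>\<^sub>1 w * Z \<theta>\<^sub>2 w = (\<Prod>t<T. exp (- D\<^sup>2 * (if fst (H w t) = p then 1 else 0)))"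
      unfolding Z_def likelihood_ratio_def prod.distrib[symmetric]
    proof (intro prod.cong refl)
      fix t assume "t \<in> {..<T}"
      then have t: "t < T" by simp
      show "(let x = chosen z \<theta>\<^sub>0 alg (fst w) (snd w) t; \<Delta> = response_mean z \<theta>\<^sub>1 x - response_mean z \<theta>\<^sub>0 x
             in exp (\<Delta> * snd w t - \<Delta>\<^sup>2 / 2)) *
            (let x = chosen z \<theta>\<^sub>0 alg (fst w) (snd w) t; \<Delta> = response_mean z \<theta>\<^sub>2 x - response_mean z \<theta>\<^sub>0 x
             in exp (\<Delta> * snd w t - \<Delta>\<^sup>2 / 2)) =
            exp (- D\<^sup>2 * (if fst (H w t) = p then 1 else 0))"
        using inX[OF w t] by (simp add: Let_def means fstH[OF t] exp_add[symmetric])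
    qed
    also have "\<dots> = exp (- D\<^sup>2 * N (H w))"
      by (simp add: exp_sum[symmetric] N_def sum_distrib_left)
    finally show ?thesis by (simp add: exp_double[symmetric])
  qed
  have pw: "c * real T * (1 - D\<^sup>2 / 2 * N (H w) - (Z \<theta>\<^sub>1 w + Z \<theta>\<^sub>2 w) / 4)
      \<le> R \<theta>\<^sub>1 (H w) * Z \<theta>\<^sub>1 w + R \<theta>\<^sub>2 (H w) * Z \<theta>\<^sub>2 w" if w: "w \<in> space ?M" for w
  proof -
    have Znn: "0 \<le> Z \<theta> w" for \<theta> by (simp add: Z_def likelihood_ratio_nonneg)
    have "1 - D\<^sup>2 / 2 * N (H w) \<le> exp (- D\<^sup>2 / 2 * N (H w))"
      using exp_ge_add_one_self[of "- D\<^sup>2 / 2 * N (H w)"] by simp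
    then have "1 - D\<^sup>2 / 2 * N (H w) - (Z \<theta>\<^sub>1 w + Z \<theta>\<^sub>2 w) / 4 \<le> min (Z \<theta>\<^sub>1 w) (Z \<theta>\<^sub>2 w)"
      using sqrt_product_le_min[OF Znn Znn ZZ[OF w, symmetric]] by linarith
    then have "c * real T * (1 - D\<^sup>2 / 2 * N (H w) - (Z \<theta>\<^sub>1 w + Z \<theta>\<^sub>2 w) / 4) \<le> (\<Sum>t<T. c * min (Z \<theta>\<^sub>1 w) (Z \<theta>\<^sub>2 w))"
      using mult_left_mono[of _ _ "c * real T"] c by (simp add: mult.assoc mult.left_commute)
    also have "\<dots> \<le> (\<Sum>t<T. gap X \<theta>\<^sub>1 (fst (H w t)) * Z \<theta>\<^sub>1 w + gap X \<theta>\<^sub>2 (fst (H w t)) * Z \<theta>\<^sub>2 w)"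
    proof (intro sum_mono)
      fix t assume "t \<in> {..<T}"
      then have x: "fst (H w t) \<in> X" using inX[OF w] by (simp add: fstH)
      have nn: "0 \<le> gap X \<theta> (fst (H w t)) * Z \<theta> w" for \<theta> using gap0[OF x] Znn by simp
      from conflict[OF x] show "c * min (Z \<theta>\<^sub>1 w) (Z \<theta>\<^sub>2 w)
          \<le> gap X \<theta>\<^sub>1 (fst (H w t)) * Z \<theta>\<^sub>1 w + gap X \<theta>\<^sub>2 (fst (H w t)) * Z \<theta>\<^sub>2 w"
      proof
        assume "c \<le> gap X \<theta>\<^sub>1 (fst (H w t))"
        then have "c * min (Z \<theta>\<^sub>1 w) (Z \<theta>\<^sub>2 w) \<le> gap X \<theta>\<^sub>1 (fst (H w t)) * Z \<theta>\<^sub>1 w"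
          using c Znn by (intro mult_mono) auto
        then show ?thesis using nn[of \<theta>\<^sub>2] by linarith
      next
        assume "c \<le> gap X \<theta>\<^sub>2 (fst (H w t))"
        then have "c * min (Z \<theta>\<^sub>1 w) (Z \<theta>\<^sub>2 w) \<le> gap X \<theta>\<^sub>2 (fst (H w t)) * Z \<theta>\<^sub>2 w"
          using c Znn by (intro mult_mono) auto
        then show ?thesis using nn[of \<theta>\<^sub>1] by linarith
      qed
    qed
    also have "\<dots> = R \<theta>\<^sub>1 (H w) * Z \<theta>\<^sub>1 w + R \<theta>\<^sub>2 (H w) * Z \<theta>\<^sub>2 w"
      by (simp add: R_def sum.distrib sum_distrib_right)
    finally show ?thesis .
  qed
  have NR: "c\<^sub>0 * (\<integral>w. N (H w) \<partial>?M) \<le> regret T X z S alg \<theta>\<^sub>0"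
  proof -
    have "(\<integral>w. c\<^sub>0 * N (H w) \<partial>?M) \<le> (\<integral>w. R \<theta>\<^sub>0 (H w) \<partial>?M)"
    proof (intro integral_mono intR integrable_mult_right intN)
      fix w assume w: "w \<in> space ?M"
      show "c\<^sub>0 * N (H w) \<le> R \<theta>\<^sub>0 (H w)"
        unfolding N_def R_def sum_distrib_left
        using inX[OF w] gap0 probe by (intro sum_mono) (auto simp: fstH)
    qed
    then show ?thesis by (simp add: reg0)
  qed
  have "c * real T * (1 / 2 - D\<^sup>2 / (2 * c\<^sub>0) * regret T X z S alg \<theta>\<^sub>0)
      \<le> c * real T * (1 / 2 - D\<^sup>2 / 2 * (\<integral>w. N (H w) \<partial>?M))"
  proof (intro mult_left_mono diff_left_mono)
    have "D\<^sup>2 / 2 * (\<integral>w. N (H w) \<partial>?M) \<le> D\<^sup>2 / 2 * (regret T X z S alg \<theta>\<^sub>0 / c\<^sub>0)"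
      using NR c\<^sub>0 by (intro mult_left_mono) (simp_all add: field_simps)
    then show "D\<^sup>2 / 2 * (\<integral>w. N (H w) \<partial>?M) \<le> D\<^sup>2 / (2 * c\<^sub>0) * regret T X z S alg \<theta>\<^sub>0" by simp
  qed (use c in simp)
  also have "\<dots> = (\<integral>w. c * real T * (1 - D\<^sup>2 / 2 * N (H w) - (Z \<theta>\<^sub>1 w + Z \<theta>\<^sub>2 w) / 4) \<partial>?M)"
    using intN intZ by (simp add: Z1 M.prob_space)
  also have "\<dots> \<le> (\<integral>w. R \<theta>\<^sub>1 (H w) * Z \<theta>\<^sub>1 w + R \<theta>\<^sub>2 (H w) * Z \<theta>\<^sub>2 w \<partial>?M)"
    using intN intZ intRZ pw by (intro integral_mono) auto
  also have "\<dots> = regret T X z S alg \<theta>\<^sub>1 + regret T X z S alg \<theta>\<^sub>2"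
    using intRZ by (simp add: regZ)
  finally show ?thesis .
qed

end

section \<open>The lower bound on the regret\<close>

lemma response_mean_hard:
  fixes i :: "'n::finite"
  assumes "0 \<le> \<alpha>" "x \<in> hard_actions i \<alpha>"
  shows "response_mean (hard_groups i) (hard_parameter i m \<epsilon>) x
    = (if x = - \<alpha> *\<^sub>R axis i 1 then - \<alpha> * m + (1 - \<alpha>) * \<epsilon> else m)"
  using assms probe_neq_axis[OF assms(1), of i]
  by (auto simp: hard_actions_def response_mean_def gam_hard om_hard hard_groups_def axis_eq_axis inner_axis'
      algebra_simps)

lemma bandit_parameter_hard:
  fixes i :: "'n::finite"
  assumes "0 \<le> \<alpha>" "\<alpha> \<le> 1" "\<bar>\<epsilon>\<bar> \<le> \<delta>" "\<delta> \<le> 1 / 2"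
  shows "bandit_parameter (hard_actions i \<alpha>) (hard_parameter i (1 - \<delta>) \<epsilon>)"
proof -
  have "\<bar>\<alpha> * (1 - \<delta> + \<epsilon>)\<bar> \<le> 1 * 1"
    unfolding abs_mult using assms by (intro mult_mono) auto
  then show ?thesis using assms
    by (auto simp: bandit_parameter_def hard_actions_def gam_hard inner_axis')
qed

theorem theorem3:
  fixes \<kappa> :: real and T :: nat
  assumes "\<kappa> \<ge> 1" and "CARD('n::finite) \<ge> 2" and "real T \<ge> 4 ^ 3 * \<kappa>"
  shows "\<exists>(X :: (real ^ 'n) set) z. (X, z) \<in> correlated_action_sets \<kappa> \<and>
           (\<forall>S alg. bandit_algorithm T X S alg \<longrightarrow>
              (\<exists>\<theta> :: real ^ 'n option. bandit_parameter X \<theta> \<and>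
                 regret T X z S alg \<theta> \<ge> \<kappa> powr (1/3) * real T powr (2/3) / (8 * exp 1)))"
proof -
  obtain i j :: 'n where ij: "j \<noteq> i"
  proof -
    have "\<not> is_singleton (UNIV :: 'n set)" using assms(2) by (simp add: is_singleton_altdef)
    then show thesis using that by (metis UNIV_I is_singletonI' UNIV_not_empty)
  qed
  \<comment> \<open>The gap \<open>2 * \<delta>\<close> balances two costs: ignoring the bias costs \<open>\<delta> T\<close>, while learning it
      takes about \<open>\<kappa> / \<delta>\<^sup>2\<close> plays of the probe, each of constant cost.\<close>
  define \<alpha> where "\<alpha> = (sqrt \<kappa> - 1) / (sqrt \<kappa> + 1)"
  define \<delta> where "\<delta> = (\<kappa> / real T) powr (1/3)"
  define r where "r = \<delta> * real T / (8 * exp 1)"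
  define X where "X = hard_actions i \<alpha>"
  define z where "z = hard_groups i"
  define p :: "real ^ 'n" where "p = - \<alpha> *\<^sub>R axis i 1"
  define \<theta> where "\<theta> = hard_parameter i (1 - \<delta>)"
  define D where "D = (1 - \<alpha>) * \<delta>"
  have T: "0 < real T" using assms by simp
  have s1: "1 \<le> sqrt \<kappa>" using assms(1) by simp
  then have s0: "0 < sqrt \<kappa> + 1" by linarith
  have \<alpha>: "0 \<le> \<alpha>" "\<alpha> < 1"
    unfolding \<alpha>_def using s1 s0 by (simp_all only: pos_le_divide_eq pos_divide_less_eq) simp_all
  have \<delta>: "0 < \<delta>" "\<delta> \<le> 1 / 4" "\<delta> ^ 3 = \<kappa> / real T"
  proof -
    show "0 < \<delta>" "\<delta> ^ 3 = \<kappa> / real T"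
      using assms T by (auto simp: \<delta>_def powr_powr simp flip: powr_realpow)
    have "\<kappa> / real T \<le> (1 / 4) ^ 3" using assms T by (simp add: field_simps)
    then show "\<delta> \<le> 1 / 4" using \<open>\<delta> ^ 3 = \<kappa> / real T\<close> by (metis power_le_imp_le_base[of \<delta> 2 "1/4"] numeral_3_eq_3 numeral_2_eq_2 zero_le_divide_1_iff zero_le_numeral)
  qed
  have target: "\<kappa> powr (1/3) * real T powr (2/3) / (8 * exp 1) = r"
  proof -
    have "real T powr (2/3) = real T powr (1 - 1/3)" by simp
    also have "\<dots> = real T / real T powr (1/3)" using T by (simp only: powr_diff) simp
    finally show ?thesis using assms T by (simp add: r_def \<delta>_def powr_divide)
  qed
  \<comment> \<open>A regret of \<open>r\<close> under \<open>\<theta> 0\<close> buys too few plays of the probe: the term subtracted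
      in the bound for three problems is at most a third of \<open>1 / 2\<close>.\<close>
  have D2: "D\<^sup>2 / (2 * (1 - \<delta>)) * r \<le> 1 / 6"
  proof -
    have "1 - \<alpha> = 2 / (sqrt \<kappa> + 1)" using s0 by (simp add: \<alpha>_def field_simps)
    also have "\<dots> \<le> 2 / sqrt \<kappa>" using assms(1) by (intro frac_le) auto
    finally have "(1 - \<alpha>)\<^sup>2 \<le> (2 / sqrt \<kappa>)\<^sup>2" using \<alpha> by (intro power_mono) auto
    then have "D\<^sup>2 \<le> 4 / \<kappa> * \<delta>\<^sup>2"
      unfolding D_def power_mult_distrib using assms(1) by (intro mult_right_mono) (auto simp: power_divide)
    then have "D\<^sup>2 / (2 * (1 - \<delta>)) \<le> (4 / \<kappa> * \<delta>\<^sup>2) / (3 / 2)"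
      using \<delta> assms(1) by (intro frac_le) auto
    moreover have "r \<le> \<delta> * real T / 16"
      unfolding r_def using \<delta> T exp_ge_add_one_self[of 1] by (intro divide_left_mono) auto
    ultimately have "D\<^sup>2 / (2 * (1 - \<delta>)) * r \<le> (4 / \<kappa> * \<delta>\<^sup>2) / (3 / 2) * (\<delta> * real T / 16)"
      using \<delta> T assms(1) by (intro mult_mono) (auto simp: r_def)
    also have "\<dots> = (\<delta> ^ 3 * real T / \<kappa>) / 6" by (simp add: power3_eq_cube power2_eq_square)
    also have "\<dots> = 1 / 6" using \<delta>(3) T assms(1) by simp
    finally show ?thesis .
  qed
  have X_cases: "(\<exists>k. x = axis k 1) \<or> x = p" if "x \<in> X" for x
    using that by (auto simp: X_def p_def hard_actions_def)
  have finX: "finite X" and axX: "axis k 1 \<in> X" for k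
    by (auto simp: X_def hard_actions_def)
  have param: "bandit_parameter X (\<theta> \<epsilon>)" if "\<bar>\<epsilon>\<bar> \<le> \<delta>" for \<epsilon>
    unfolding X_def \<theta>_def using \<alpha> \<delta> that by (intro bandit_parameter_hard) auto
  have mean: "response_mean z (\<theta> \<epsilon>) x - response_mean z (\<theta> 0) x = (if x = p then (1 - \<alpha>) * \<epsilon> else 0)"
    if "x \<in> X" for x \<epsilon>
    using response_mean_hard[OF \<alpha>(1) that[unfolded X_def]] by (simp add: z_def \<theta>_def p_def)
  have gam: "axis k 1 \<bullet> gam (\<theta> \<epsilon>) = (if k = i then 1 - \<delta> + \<epsilon> else 1 - \<delta> - \<epsilon>)"
    "p \<bullet> gam (\<theta> \<epsilon>) = - \<alpha> * (1 - \<delta> + \<epsilon>)" for k \<epsilon>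
    by (simp_all add: \<theta>_def p_def gam_hard inner_axis')
  have probe: "1 - \<delta> \<le> gap X (\<theta> 0) p"
    using gap_ge[OF finX axX[of i], of p "\<theta> 0"] mult_nonneg_nonneg[OF \<alpha>(1), of "1 - \<delta>"] \<delta>
    by (simp add: inner_diff_left gam)
  have conflict: "2 * \<delta> \<le> gap X (\<theta> \<delta>) x \<or> 2 * \<delta> \<le> gap X (\<theta> (- \<delta>)) x" if "x \<in> X" for x
  proof -
    from X_cases[OF that] consider "x = axis i 1" | k where "k \<noteq> i" "x = axis k 1" | "x = p" by metis
    then show ?thesis
    proof cases
      case 1
      then show ?thesis using gap_ge[OF finX axX[of j], of x "\<theta> (- \<delta>)"] ij
        by (simp add: inner_diff_left gam)
    next
      case 2
      then show ?thesis using gap_ge[OF finX axX[of i], of x "\<theta> \<delta>"]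
        by (simp add: inner_diff_left gam)
    next
      case 3
      then show ?thesis using gap_ge[OF finX axX[of i], of x "\<theta> \<delta>"] \<alpha> \<delta>
        by (simp add: inner_diff_left gam)
    qed
  qed
  have "\<exists>\<theta>. bandit_parameter X \<theta> \<and> r \<le> regret T X z S alg \<theta>" if alg: "bandit_algorithm T X S alg" for S alg
  proof (rule ccontr)
    assume "\<not> ?thesis"
    then have small: "regret T X z S alg (\<theta> \<epsilon>) < r" if "\<bar>\<epsilon>\<bar> \<le> \<delta>" for \<epsilon>
      using param[OF that] by force
    interpret bandit_interaction T X z S alg by unfold_locales (rule alg)
    have "2 * \<delta> * real T * (1 / 2 - 1 / 6) \<le> 2 * \<delta> * real T * (1 / 2 - D\<^sup>2 / (2 * (1 - \<delta>)) * regret T X z S alg (\<theta> 0))"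
    proof (intro mult_left_mono diff_left_mono)
      have "D\<^sup>2 / (2 * (1 - \<delta>)) * regret T X z S alg (\<theta> 0) \<le> D\<^sup>2 / (2 * (1 - \<delta>)) * r"
        using small[of 0] \<delta> by (intro mult_left_mono) auto
      then show "D\<^sup>2 / (2 * (1 - \<delta>)) * regret T X z S alg (\<theta> 0) \<le> 1 / 6" using D2 by linarith
    qed (use \<delta> T in auto)
    also have "\<dots> \<le> regret T X z S alg (\<theta> \<delta>) + regret T X z S alg (\<theta> (- \<delta>))"
      using \<delta> mean probe conflict by (intro three_point_bound finX) (auto simp: D_def)
    also have "\<dots> < 2 * r" using small[of \<delta>] small[of "- \<delta>"] \<delta> by simp
    also have "\<dots> \<le> \<delta> * real T / 8"
      unfolding r_def using \<delta> T exp_ge_add_one_self[of 1] by (simp add: field_simps)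
    finally show False using mult_pos_pos[OF \<delta>(1) T] by simp
  qed
  moreover have "(X, z) \<in> correlated_action_sets \<kappa>"
    unfolding X_def z_def by (rule hard_correlated[OF assms(1) \<alpha>_def])
  ultimately show ?thesis unfolding target by blast
qed

end
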